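(* Let $d\geq 2$ be an integer and let $(G_n)_{n\geq 0}$ be a deterministic sequence of finite connected graphs. Suppose that there exist a sequence of nonnegative integers $f(n)\to\infty$ as $n\to\infty$ and an integer $k\geq 3$ such that $$\frac{\#\{v\in G_n : \mathrm{Ball}_{G_n}(v,f(n)) \text{ is a } k\text{-regular tree up to level } f(n)\}}{|G_n|}\longrightarrow 1 \quad\text{as } n\to\infty .$$ Then for all $M\geq 0$, $G_n$ eventually cannot be $M$-uniform packed in $\mathbb{R}^d$; that is, for every $M\geq 0$ there is $n_0$ such that for all $n\geq n_0$ the graph $G_n$ is not $M$-uniform in dimension $d$.
   Context: $|G_n|$ is the number of vertices of $G_n$, and $\mathrm{Ball}_{G}(v,r)$ is the closed ball of radius $r$ around $v$ in $G$ for the graph distance, viewed as an induced subgraph rooted at $v$. It "is a $k$-regular tree up to level $r$" if it is isomorphic, as a rooted graph, to the closed ball of radius $r$ around a vertex in the infinite tree all of whose vertices have degree $k$. A $d$-sphere packing is a collection $P=(B_v, v\in V)$ of $d$-dimensional closed balls in $\mathbb{R}^d$ with radii $r_v>0$ and pairwise disjoint interiors. Its tangency graph is the unoriented graph with vertex set $V$ in which distinct $u,v$ are joined by an edge if and only if $B_u$ and $B_v$ are tangent. The packing is $M$-uniform if for any tangent balls $B_u,B_v$ one has $r_u/r_v\leq M$. A graph is $M$-uniform in dimension $d$ (can be $M$-uniform packed in $\mathbb{R}^d$) if it is (isomorphic to) the tangency graph of an $M$-uniform $d$-sphere packing in $\mathbb{R}^d$. *)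

theory Defs
  imports "Graph_Theory.Graph_Theory" "HOL-Analysis.Analysis"
begin

text \<open>
  Graphs are simple and undirected: symmetric, loop-free arc relations, that is
  \<open>pair_graph\<close> for finite graphs and \<open>pair_bidirected_digraph\<close> for possibly infinite ones.
  An undirected edge is a pair of opposite arcs.
\<close>

text \<open>Graph distance: least number of edges on a walk, \<open>\<infinity>\<close> if there is none.\<close>

definition graph_dist :: "'a pair_pre_digraph \<Rightarrow> 'a \<Rightarrow> 'a \<Rightarrow> ereal" where
  "graph_dist G u v = wf_digraph.\<mu> (with_proj G) (\<lambda>_. 1) u v"

definition graph_ball :: "'a pair_pre_digraph \<Rightarrow> 'a \<Rightarrow> nat \<Rightarrow> ('a, 'a \<times> 'a) pre_digraph" where
  "graph_ball G v r = with_proj G \<restriction> {u \<in> pverts G. graph_dist G v u \<le> ereal (real r)}"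

definition rooted_iso :: "('a, 'b) pre_digraph \<Rightarrow> 'a \<Rightarrow> ('c, 'd) pre_digraph \<Rightarrow> 'c \<Rightarrow> bool" where
  "rooted_iso G u H v \<longleftrightarrow>
     (\<exists>h. pre_digraph.digraph_isomorphism G h \<and> H = app_iso h G \<and> iso_verts h u = v)"

text \<open>
  The library constant \<open>tree\<close> is not usable here: for a symmetric digraph, \<open>cycle\<close> also counts
  the closed walk \<open>u, v, u\<close> along a single edge. In a loop-free graph without parallel arcs, the
  directed cycles with at least three arcs are exactly the cycles of the undirected graph.
\<close>

definition undirected_tree :: "'a pair_pre_digraph \<Rightarrow> bool" where
  "undirected_tree T \<longleftrightarrow>
     pair_bidirected_digraph T \<and> Digraph_Component.connected (with_proj T) \<and>
     \<not> (\<exists>p. pre_digraph.cycle (with_proj T) p \<and> 3 \<le> length p)"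

text \<open>Finiteness is required because \<open>out_degree\<close> is \<open>0\<close> on infinite sets of arcs.\<close>

definition regular_tree :: "nat \<Rightarrow> 'a pair_pre_digraph \<Rightarrow> bool" where
  "regular_tree k T \<longleftrightarrow> undirected_tree T \<and>
     (\<forall>v \<in> pverts T. finite (out_arcs (with_proj T) v) \<and> out_degree (with_proj T) v = k)"

text \<open>
  The \<open>k\<close>-regular tree is unique up to isomorphism, vertex-transitive and countable, so the
  choices of \<open>T\<close>, of its root, and of \<open>nat\<close> as its vertex type are immaterial.
\<close>

definition regular_tree_up_to :: "nat \<Rightarrow> 'a pair_pre_digraph \<Rightarrow> 'a \<Rightarrow> nat \<Rightarrow> bool" where
  "regular_tree_up_to k G v r \<longleftrightarrow>
     (\<exists>(T :: nat pair_pre_digraph) x. regular_tree k T \<and> x \<in> pverts T \<and>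
        rooted_iso (graph_ball G v r) v (graph_ball T x r) x)"

text \<open>
  A ball \<open>B\<^sub>v\<close> is given by its centre \<open>c v\<close> and its radius \<open>r v\<close>; the dimension is the
  cardinality of \<open>'d\<close>.
\<close>

definition sphere_packing :: "'v set \<Rightarrow> ('v \<Rightarrow> real ^ 'd) \<Rightarrow> ('v \<Rightarrow> real) \<Rightarrow> bool" where
  "sphere_packing V c r \<longleftrightarrow> (\<forall>v \<in> V. 0 < r v) \<and>
     disjoint_family_on (\<lambda>v. interior (cball (c v) (r v))) V"

text \<open>Balls with disjoint interiors can only be tangent externally.\<close>

definition tangent :: "('v \<Rightarrow> real ^ 'd) \<Rightarrow> ('v \<Rightarrow> real) \<Rightarrow> 'v \<Rightarrow> 'v \<Rightarrow> bool" where
  "tangent c r u v \<longleftrightarrow> u \<noteq> v \<and> dist (c u) (c v) = r u + r v"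

definition tangency_graph ::
    "'v set \<Rightarrow> ('v \<Rightarrow> real ^ 'd) \<Rightarrow> ('v \<Rightarrow> real) \<Rightarrow> 'v pair_pre_digraph" where
  "tangency_graph V c r =
     \<lparr> pverts = V, parcs = {(u, v). u \<in> V \<and> v \<in> V \<and> tangent c r u v} \<rparr>"

definition uniform_packing ::
    "real \<Rightarrow> 'v set \<Rightarrow> ('v \<Rightarrow> real ^ 'd) \<Rightarrow> ('v \<Rightarrow> real) \<Rightarrow> bool" where
  "uniform_packing M V c r \<longleftrightarrow> sphere_packing V c r \<and>
     (\<forall>u \<in> V. \<forall>v \<in> V. tangent c r u v \<longrightarrow> r u / r v \<le> M)"

text \<open>
  Taking the index set of the packing inside the vertex type of \<open>G\<close> is no restriction, since
  the index set has to be in bijection with the vertices of \<open>G\<close>.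
\<close>

definition uniform_in_dim :: "'d::finite itself \<Rightarrow> real \<Rightarrow> 'a pair_pre_digraph \<Rightarrow> bool" where
  "uniform_in_dim _ M G \<longleftrightarrow>
     (\<exists>(V :: 'a set) (c :: 'a \<Rightarrow> real ^ 'd) r. uniform_packing M V c r \<and>
        digraph_iso (with_proj G) (with_proj (tangency_graph V c r)))"

end

theory Submission
  imports Defs
begin

text \<open>
  Uniform packings have hyperfinite tangency graphs, uniformly in the packing. Normalise the radii to
  be at least \<open>1\<close> and consider the dyadic cubes of a randomly shifted grid. Greedily cut off
  minimal cubes containing \<open>K\<close> remaining centres: at most \<open>n / K\<close> cubes are cut, and the remaining
  pieces have at most \<open>2 ^ d * K\<close> centres. An edge at \<open>v\<close> has length at most \<open>(M + 1) * r v\<close>.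
  On average over the shift it rarely crosses the boundary of a cube of side greater than
  \<open>T * r v\<close>, since the crossing probabilities over the scales form a geometric series; and a cube
  of side \<open>l\<close> contains boundedly many centres with \<open>l \<le> T * r v\<close>. Choosing first \<open>T\<close> and then
  \<open>K\<close> large, at most \<open>\<epsilon> * n\<close> edges are cut.

  On the other hand, if almost all balls of radius \<open>R\<close> are trees, then the edges inside pieces of
  size at most \<open>R\<close> form a forest on the good vertices, so there are at most \<open>n\<close> of them, whereas
  \<open>k\<close>-regularity with \<open>k \<ge> 3\<close> provides almost \<open>3 * n / 2\<close> edges.
\<close>

section \<open>Forests\<close>

text \<open>The closing arc is kept apart from the list, so that distinctness of the vertices can be
  required outright. Length at least 3 excludes a single edge walked back and forth.\<close>

definition undirected_cycle :: "'a rel \<Rightarrow> 'a list \<Rightarrow> bool" where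
  "undirected_cycle E p \<longleftrightarrow> 3 \<le> length p \<and> distinct p \<and>
     successively (\<lambda>u v. (u, v) \<in> E) p \<and> (last p, hd p) \<in> E"

text \<open>The first vertex of a longest path works: maximality puts all its neighbours on the
  path, and a neighbour beyond the second vertex would close a cycle.\<close>

lemma acyclic_has_leaf:
  assumes "finite V" "V \<noteq> {}" "E \<subseteq> V \<times> V" "sym E" "irrefl E"
    and acyclic: "\<And>p. \<not> undirected_cycle E p"
  obtains v where "v \<in> V" "card (E `` {v}) \<le> 1"
proof -
  let ?path = "\<lambda>p. p \<noteq> [] \<and> set p \<subseteq> V \<and> distinct p \<and> successively (\<lambda>u v. (u, v) \<in> E) p"
  obtain w where "w \<in> V" using assms by auto
  then have "?path [w]" by simp
  moreover have "\<forall>p. ?path p \<longrightarrow> length p < Suc (card V)"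
    by (metis assms(1) card_mono distinct_card le_imp_less_Suc)
  ultimately obtain p where p: "?path p" and p_max: "\<And>q. ?path q \<Longrightarrow> length q \<le> length p"
    using ex_has_greatest_nat[of ?path "[w]" length "Suc (card V)"] by blast
  define v where "v = hd p"
  have nbr: "u \<in> set (tl p)" if "(v, u) \<in> E" for u
  proof -
    have "(u, v) \<in> E" using that assms(4) by (simp add: sym_def)
    then have "u \<in> set p"
      using p p_max[of "u # p"] assms(3)
      by (cases p) (auto simp: v_def)
    moreover have "u \<noteq> v" using that assms(5) by (auto simp: irrefl_def)
    ultimately show ?thesis using p by (cases p) (auto simp: v_def)
  qed
  \<comment> \<open>If \<open>p\<close> has a single vertex, \<open>p ! 1\<close> is unspecified,
    but then \<open>tl p\<close> is empty and by \<open>nbr\<close> so is the left-hand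
    side.\<close>
  have "E `` {v} \<subseteq> {p ! 1}"
  proof
    fix u assume "u \<in> E `` {v}"
    then have u: "(v, u) \<in> E" by simp
    then obtain i where i: "i < length (tl p)" "u = tl p ! i"
      using nbr by (metis in_set_conv_nth)
    have "i = 0"
    proof (rule ccontr)
      assume "i \<noteq> 0"
      \<comment> \<open>\<open>u\<close> is entry \<open>i + 1\<close> of \<open>p\<close>, so this
        prefix runs from \<open>v\<close> to \<open>u\<close> and has at least three
        vertices.\<close>
      let ?q = "take (i + 2) p"
      have "successively (\<lambda>u v. (u, v) \<in> E) ?q"
        using p by (metis append_take_drop_id successively_append_iff)
      moreover have "last ?q = u"
        using i by (subst last_conv_nth) (auto simp: nth_tl min_def intro: arg_cong[of _ _ "(!) p"])
      moreover have "hd ?q = v" using p by (simp add: v_def)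
      ultimately have "undirected_cycle E ?q"
        using p i \<open>i \<noteq> 0\<close> u assms(4) by (auto simp: undirected_cycle_def sym_def)
      with acyclic show False by blast
    qed
    with i show "u \<in> {p ! 1}" by (simp add: nth_tl)
  qed
  then have "card (E `` {v}) \<le> 1"
    using card_mono[of "{p ! 1}"] by simp
  moreover have "v \<in> V" using p by (auto simp: v_def)
  ultimately show ?thesis using that by blast
qed

lemma successively_subrel:
  assumes "successively (\<lambda>u v. (u, v) \<in> E) p" "E \<subseteq> F"
  shows "successively (\<lambda>u v. (u, v) \<in> F) p"
  using assms by (induction p rule: induct_list012) auto

text \<open>Induction by deleting a leaf. Both orientations of an edge are counted, so a leaf costs
  at most two arcs, whence the factor 2.\<close>

lemma card_acyclic_le:
  assumes "finite V" "E \<subseteq> V \<times> V" "sym E" "irrefl E" "\<And>p. \<not> undirected_cycle E p"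
  shows "card E \<le> 2 * card V"
  using assms
proof (induction "card V" arbitrary: V E)
  case 0
  then show ?case by simp
next
  case (Suc n)
  then have "V \<noteq> {}" by auto
  with Suc obtain v where v: "v \<in> V" "card (E `` {v}) \<le> 1"
    using acyclic_has_leaf[of V E] by metis
  let ?V = "V - {v}" and ?E = "E \<inter> (V - {v}) \<times> (V - {v})"
  have "finite E" using Suc.prems finite_subset by blast
  have "\<not> undirected_cycle ?E p" for p
    using Suc.prems(5)[of p] successively_subrel[of ?E p E] by (auto simp: undirected_cycle_def)
  moreover have "n = card ?V" using Suc v by simp
  ultimately have "card ?E \<le> 2 * card ?V"
    using Suc.prems by (intro Suc.hyps(1)) (auto simp: sym_def irrefl_def)
  moreover have "E \<subseteq> ?E \<union> (Pair v ` (E `` {v}) \<union> (\<lambda>u. (u, v)) ` (E `` {v}))"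
    using Suc.prems(2,3) by (fastforce simp: sym_def)
  then have "card E \<le> card (?E \<union> (Pair v ` (E `` {v}) \<union> (\<lambda>u. (u, v)) ` (E `` {v})))"
    using \<open>finite E\<close> by (intro card_mono) auto
  then have "card E \<le> card ?E + (card (E `` {v}) + card (E `` {v}))"
    using \<open>finite E\<close>
    by (meson add_mono card_Un_le card_image_le finite_Image finite.emptyI finite.insertI le_refl order_trans)
  ultimately show ?case using v Suc.hyps(2) \<open>n = card ?V\<close> by linarith
qed

section \<open>Cutting nested partitions\<close>

lemma card_class_le:
  assumes "finite W" "card (g ` W) \<le> D" "\<And>z. card {w \<in> W. g w = z} \<le> K"
  shows "card W \<le> D * K"
proof -
  have "card W = card (\<Union>z\<in>g ` W. {w \<in> W. g w = z})" by (rule arg_cong[of _ _ card]) auto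
  also have "\<dots> \<le> (\<Sum>z\<in>g ` W. card {w \<in> W. g w = z})" using assms by (intro card_UN_le) auto
  also have "\<dots> \<le> card (g ` W) * K" using sum_bounded_above[of "g ` W" "\<lambda>z. card {w \<in> W. g w = z}" K] assms(3) by simp
  also have "\<dots> \<le> D * K" using assms(2) by simp
  finally show ?thesis .
qed

text \<open>
  Repeatedly remove a lowest cell that still holds at least \<open>K\<close> points. Since its children hold
  fewer, it holds at most \<open>D * K\<close> points, and at most \<open>card W / K\<close> cells are ever removed.
\<close>

lemma cut_cells:
  fixes cell :: "nat \<Rightarrow> 'a \<Rightarrow> 'c"
  assumes "finite V" "0 < K" "\<And>v. v \<in> V \<Longrightarrow> cell (Suc m) v = z0"
    and children: "\<And>j z. j \<le> m \<Longrightarrow> card (cell j ` {v \<in> V. cell (Suc j) v = z}) \<le> D"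
    and bottom: "\<And>z. card {v \<in> V. cell 0 v = z} < K"
    and "W \<subseteq> V"
  shows "\<exists>Q. finite Q \<and> fst ` Q \<subseteq> {..m} \<and> K * card Q \<le> card W \<and>
    (\<forall>v\<in>W. card {w \<in> W. \<forall>(j, z)\<in>Q. cell j w = z \<longleftrightarrow> cell j v = z} \<le> D * K)"
  using \<open>W \<subseteq> V\<close>
proof (induction "card W" arbitrary: W rule: less_induct)
  case less
  then have fin: "finite W" using assms(1) finite_subset by blast
  have sub: "card (cell j ` {w \<in> W. cell (Suc j) w = z}) \<le> D" if "j \<le> m" for j z
  proof -
    have "cell j ` {w \<in> W. cell (Suc j) w = z} \<subseteq> cell j ` {v \<in> V. cell (Suc j) v = z}"
      using less.prems by auto
    then have "card (cell j ` {w \<in> W. cell (Suc j) w = z}) \<le>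
        card (cell j ` {v \<in> V. cell (Suc j) v = z})"
      using assms(1) by (intro card_mono) auto
    also have "\<dots> \<le> D" by (rule children[OF that])
    finally show ?thesis .
  qed
  have small: "card {w \<in> W. cell (Suc j) w = z} \<le> D * K"
    if "j \<le> m" "\<And>z. card {w \<in> W. cell j w = z} < K" for j z
  proof (rule card_class_le[where g = "cell j"])
    show "card {w \<in> {w \<in> W. cell (Suc j) w = z}. cell j w = z'} \<le> K" for z'
    proof -
      have "card {w \<in> {w \<in> W. cell (Suc j) w = z}. cell j w = z'} \<le> card {w \<in> W. cell j w = z'}"
        using fin by (intro card_mono) auto
      with that(2)[of z'] show ?thesis by linarith
    qed
  qed (use sub[OF that(1)] fin in auto)
  show ?case
  proof (cases "\<exists>j. j \<le> m \<and> (\<exists>z. K \<le> card {w \<in> W. cell j w = z})")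
    case True
    define j where "j = (LEAST j. j \<le> m \<and> (\<exists>z. K \<le> card {w \<in> W. cell j w = z}))"
    have j: "j \<le> m" "\<exists>z. K \<le> card {w \<in> W. cell j w = z}"
      using LeastI_ex[OF True] by (auto simp: j_def)
    have j_min: "card {w \<in> W. cell i w = z} < K" if "i < j" for i z
      using not_less_Least[OF that[unfolded j_def]] that j(1) by (auto simp: not_le)
    obtain z where z: "K \<le> card {w \<in> W. cell j w = z}" using j by auto
    have "card {w \<in> W. cell 0 w = z} \<le> card {v \<in> V. cell 0 v = z}"
      using assms(1) less.prems by (intro card_mono) auto
    \<comment> \<open>Level 0 is excluded by \<open>bottom\<close>, so the lowest full cell has a
      level \<open>i\<close> of children below it, to which \<open>small\<close> applies.\<close>
    with bottom[of z] z obtain i where i: "j = Suc i" by (cases j) auto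
    let ?P = "{w \<in> W. cell j w = z}" and ?W = "{w \<in> W. cell j w \<noteq> z}"
    have P: "card ?P \<le> D * K" using small[of i] j_min[of i] j(1) i by auto
    have split: "card W = card ?P + card ?W"
      using fin by (subst card_Un_disjoint[symmetric]) (auto intro: arg_cong[of _ _ card])
    then obtain Q where Q: "finite Q" "fst ` Q \<subseteq> {..m}" "K * card Q \<le> card ?W"
      "\<And>v. v \<in> ?W \<Longrightarrow> card {w \<in> ?W. \<forall>(j, z)\<in>Q. cell j w = z \<longleftrightarrow> cell j v = z} \<le> D * K"
      using less.hyps[of ?W] less.prems z assms(2) by auto
    let ?Q = "insert (j, z) Q"
    have "card {w \<in> W. \<forall>(j, z)\<in>?Q. cell j w = z \<longleftrightarrow> cell j v = z} \<le> D * K" (is "card ?C \<le> _")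
      if "v \<in> W" for v
    proof (cases "cell j v = z")
      case True
      then have "?C \<subseteq> ?P" by auto
      then have "card ?C \<le> card ?P" using fin by (intro card_mono) auto
      with P show ?thesis by linarith
    next
      case False
      then have "?C = {w \<in> ?W. \<forall>(j, z)\<in>Q. cell j w = z \<longleftrightarrow> cell j v = z}" by auto
      with Q(4)[of v] that False show ?thesis by simp
    qed
    moreover have "K * card ?Q \<le> card W"
    proof -
      have "K * card ?Q \<le> K * (card Q + 1)"
        using Q(1) by (simp add: card_insert_if)
      also have "\<dots> \<le> card W" using Q(3) z split by simp
      finally show ?thesis .
    qed
    ultimately show ?thesis using Q j(1) by (intro exI[of _ ?Q]) auto
  next
    case False
    \<comment> \<open>No cell up to level \<open>m\<close> is full, so the single cell of level
      \<open>Suc m\<close>, which is all of \<open>W\<close>, is small and nothing has to be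
      cut.\<close>
    then have "card {w \<in> W. cell m w = z} < K" for z by (meson le_refl not_le)
    then have "card {w \<in> W. cell (Suc m) w = z0} \<le> D * K" by (intro small) auto
    moreover have "{w \<in> W. cell (Suc m) w = z0} = W" using assms(3) less.prems by auto
    ultimately show ?thesis using fin
      by (intro exI[of _ "{}"]) auto
  qed
qed

section \<open>Shifted grids and separated points\<close>

text \<open>The smallest exponent \<open>a\<close> in \<open>J\<close> controls the sum: it is at
  most the geometric tail \<open>2 / 2 ^ a\<close>, and \<open>c < 2 ^ a\<close>.\<close>

lemma sum_inverse_power2_le:
  fixes c :: real
  assumes "finite J" "0 < c" "\<And>j. j \<in> J \<Longrightarrow> c < 2 ^ j"
  shows "(\<Sum>j\<in>J. 1 / 2 ^ j) \<le> 2 / c"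
proof (cases "J = {}")
  case False
  define a where "a = Min J"
  have a: "a \<in> J" "\<And>j. j \<in> J \<Longrightarrow> a \<le> j" using False assms(1) by (auto simp: a_def)
  have geometric: "(\<Sum>j=a..<a + n. 1 / 2 ^ j :: real) = 2 / 2 ^ a - 2 / 2 ^ (a + n)" for n
    by (induction n) simp_all
  have "J \<subseteq> {a..<a + (Suc (Max J) - a)}"
  proof
    fix j assume "j \<in> J"
    then have "a \<le> j" "j \<le> Max J" using a assms(1) by auto
    then show "j \<in> {a..<a + (Suc (Max J) - a)}" by auto
  qed
  then have "(\<Sum>j\<in>J. 1 / 2 ^ j :: real) \<le> (\<Sum>j=a..<a + (Suc (Max J) - a). 1 / 2 ^ j)"
    by (intro sum_mono2) auto
  also have "\<dots> \<le> 2 / 2 ^ a" unfolding geometric by simp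
  also have "\<dots> \<le> 2 / c" using assms(2,3) a(1) by (intro divide_left_mono) (auto intro: less_imp_le)
  finally show ?thesis .
qed (use assms in auto)

text \<open>A variant of Hermite's identity, proved by telescoping in \<open>t\<close>.\<close>

lemma sum_floor_shift:
  fixes x :: real
  assumes "0 < s"
  shows "(\<Sum>t<q * s. \<lfloor>(x + real k + real t) / real s\<rfloor>) =
    (\<Sum>t<q * s. \<lfloor>(x + real t) / real s\<rfloor>) + int (k * q)"
proof (induction k)
  case (Suc k)
  let ?f = "\<lambda>t. \<lfloor>(x + real k + real t) / real s\<rfloor>"
  have "(\<Sum>t<q * s. \<lfloor>(x + real (Suc k) + real t) / real s\<rfloor>) - (\<Sum>t<q * s. ?f t) =
      (\<Sum>t<q * s. ?f (Suc t) - ?f t)"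
    by (simp add: sum_subtractf algebra_simps)
  also have "\<dots> = ?f (q * s) - ?f 0" by (rule sum_lessThan_telescope)
  \<comment> \<open>The \<open>q * s\<close> shifts make up \<open>q\<close> full periods, so the
    two ends of the telescope differ by exactly \<open>q\<close>.\<close>
  also have "(x + real k + real (q * s)) / real s = (x + real k) / real s + of_int (int q)"
    using assms by (simp add: field_simps)
  then have "?f (q * s) - ?f 0 = int q" by (simp only: floor_add_int) simp
  finally show ?case using Suc by (simp add: algebra_simps)
qed simp

text \<open>For \<open>x \<le> y\<close> each separating shift contributes at least 1 to the sum of
  the floor differences. Rounding \<open>y - x\<close> up to an integer, which accounts for the
  \<open>+ 1\<close>, lets \<open>sum_floor_shift\<close> bound that sum.\<close>

lemma card_floor_separating_shifts:
  fixes x y :: real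
  assumes "0 < s"
  shows "real (card {t. t < q * s \<and> \<lfloor>(x + real t) / real s\<rfloor> \<noteq> \<lfloor>(y + real t) / real s\<rfloor>})
    \<le> real q * (\<bar>x - y\<bar> + 1)"
proof -
  have "real (card {t. t < q * s \<and> \<lfloor>(x + real t) / real s\<rfloor> \<noteq> \<lfloor>(y + real t) / real s\<rfloor>})
    \<le> real q * (y - x + 1)" if "x \<le> y" for x y :: real
  proof -
    let ?f = "\<lambda>x t. \<lfloor>(x + real t) / real s\<rfloor>"
    define k where "k = nat \<lceil>y - x\<rceil>"
    have k: "y \<le> x + real k" "real k \<le> y - x + 1"
      using that unfolding k_def by linarith+
    have "int (card {t. t < q * s \<and> ?f x t \<noteq> ?f y t}) = (\<Sum>t<q * s. of_bool (?f x t \<noteq> ?f y t))"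
      by (simp add: sum_of_bool_eq Int_def)
    also have "\<dots> \<le> (\<Sum>t<q * s. ?f y t - ?f x t)"
    proof (rule sum_mono)
      fix t
      have "?f x t \<le> ?f y t" using that assms by (intro floor_mono divide_right_mono) auto
      then show "of_bool (?f x t \<noteq> ?f y t) \<le> ?f y t - ?f x t" by auto
    qed
    also have "\<dots> \<le> (\<Sum>t<q * s. ?f (x + real k) t - ?f x t)"
      using k(1) assms by (intro sum_mono diff_right_mono floor_mono divide_right_mono) auto
    also have "\<dots> = int (k * q)" using sum_floor_shift[OF assms, of x k q] by (simp add: sum_subtractf)
    finally have "real (card {t. t < q * s \<and> ?f x t \<noteq> ?f y t}) \<le> real (k * q)"
      by (simp only: of_nat_le_iff)
    then have "real (card {t. t < q * s \<and> ?f x t \<noteq> ?f y t}) \<le> real k * real q" by simp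
    also have "\<dots> \<le> (y - x + 1) * real q" using k(2) by (intro mult_right_mono) auto
    finally show ?thesis by (simp add: mult.commute)
  qed
  note ordered = this
  show ?thesis
  proof (cases "x \<le> y")
    case True
    with ordered[OF True] show ?thesis by simp
  next
    case False
    have "{t. t < q * s \<and> \<lfloor>(x + real t) / real s\<rfloor> \<noteq> \<lfloor>(y + real t) / real s\<rfloor>} =
        {t. t < q * s \<and> \<lfloor>(y + real t) / real s\<rfloor> \<noteq> \<lfloor>(x + real t) / real s\<rfloor>}"
      by (rule Collect_cong) auto
    with ordered[of y x] False show ?thesis by simp
  qed
qed

text \<open>First moment argument over the \<open>2 ^ m\<close> shifts: scale \<open>2 ^ j\<close>
  separates a fixed pair with probability at most \<open>(D + 1) * w a / 2 ^ j\<close>, and summing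
  over \<open>2 ^ j > T * w a\<close> gives at most \<open>2 * (D + 1) / T\<close>. Some shift does
  no worse than the average.\<close>

lemma exists_good_shift:
  fixes x y w :: "'b \<Rightarrow> real"
  assumes "finite A" "0 \<le> D" "0 < T"
    and w: "\<And>a. a \<in> A \<Longrightarrow> 1 \<le> w a" and near: "\<And>a. a \<in> A \<Longrightarrow> \<bar>x a - y a\<bar> \<le> D * w a"
  obtains t :: nat where "t < 2 ^ m"
    "real (card {a \<in> A. \<exists>j\<le>m. T * w a < 2 ^ j \<and>
       \<lfloor>(x a + real t) / 2 ^ j\<rfloor> \<noteq> \<lfloor>(y a + real t) / 2 ^ j\<rfloor>}) \<le> 2 * (D + 1) / T * real (card A)"
proof -
  define sep where "sep a j t \<longleftrightarrow> \<lfloor>(x a + real t) / 2 ^ j\<rfloor> \<noteq> \<lfloor>(y a + real t) / 2 ^ j\<rfloor>" for a j t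
  define bad where "bad a t \<longleftrightarrow> (\<exists>j\<le>m. T * w a < 2 ^ j \<and> sep a j t)" for a t
  let ?C = "2 * (D + 1) / T"
  have one: "real (card {t. t < 2 ^ m \<and> bad a t}) \<le> 2 ^ m * ?C" if a: "a \<in> A" for a
  proof -
    define J where "J = {j. j \<le> m \<and> T * w a < 2 ^ j}"
    have wa: "1 \<le> w a" using w[OF a] .
    have "finite J" by (simp add: J_def)
    have "{t. t < 2 ^ m \<and> bad a t} = (\<Union>j\<in>J. {t. t < 2 ^ m \<and> sep a j t})"
      by (auto simp: J_def bad_def)
    then have "card {t. t < 2 ^ m \<and> bad a t} \<le> (\<Sum>j\<in>J. card {t. t < 2 ^ m \<and> sep a j t})"
      using card_UN_le[OF \<open>finite J\<close>, of "\<lambda>j. {t. t < 2 ^ m \<and> sep a j t}"] by simp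
    then have "real (card {t. t < 2 ^ m \<and> bad a t}) \<le> (\<Sum>j\<in>J. real (card {t. t < 2 ^ m \<and> sep a j t}))"
      by (simp only: of_nat_sum[symmetric] of_nat_le_iff)
    also have "\<dots> \<le> (\<Sum>j\<in>J. (2 ^ m * (D + 1) * w a) * (1 / 2 ^ j))"
    proof (rule sum_mono)
      fix j assume "j \<in> J"
      \<comment> \<open>The shifts below \<open>2 ^ m\<close> form \<open>2 ^ (m - j)\<close>
        periods of length \<open>2 ^ j\<close>.\<close>
      then have pow: "(2::nat) ^ (m - j) * 2 ^ j = 2 ^ m"
        by (simp add: J_def flip: power_add)
      have "real (card {t. t < 2 ^ m \<and> sep a j t}) \<le> real (2 ^ (m - j)) * (\<bar>x a - y a\<bar> + 1)"
        using card_floor_separating_shifts[of "2 ^ j" "2 ^ (m - j)" "x a" "y a"]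
        by (simp add: pow sep_def)
      \<comment> \<open>Here \<open>1 \<le> w a\<close> absorbs the rounding term of the integer
        shifts.\<close>
      also have "\<dots> \<le> real (2 ^ (m - j)) * ((D + 1) * w a)"
        using near[OF a] wa by (intro mult_left_mono) (auto simp: algebra_simps)
      also have "real (2 ^ (m - j)) = 2 ^ m * (1 / 2 ^ j)"
        using arg_cong[OF pow, of real] by (simp add: field_simps)
      finally show "real (card {t. t < 2 ^ m \<and> sep a j t}) \<le> (2 ^ m * (D + 1) * w a) * (1 / 2 ^ j)"
        by (simp add: mult_ac)
    qed
    also have "\<dots> = (2 ^ m * (D + 1) * w a) * (\<Sum>j\<in>J. 1 / 2 ^ j)" by (simp add: sum_distrib_left)
    also have "\<dots> \<le> (2 ^ m * (D + 1) * w a) * (2 / (T * w a))"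
      using assms(2,3) wa \<open>finite J\<close>
      by (intro mult_left_mono sum_inverse_power2_le) (auto simp: J_def)
    also have "\<dots> = 2 ^ m * ?C" using wa assms(3) by (simp add: field_simps)
    finally show ?thesis .
  qed
  have "\<exists>t<2 ^ m. real (card {a \<in> A. bad a t}) \<le> ?C * real (card A)"
  proof (rule ccontr)
    assume "\<not> ?thesis"
    then have "(\<Sum>t::nat<2 ^ m. ?C * real (card A)) < (\<Sum>t::nat<2 ^ m. real (card {a \<in> A. bad a t}))"
      by (intro sum_strict_mono) (auto simp: not_le lessThan_empty_iff)
    also have "\<dots> = (\<Sum>t::nat<2 ^ m. \<Sum>a\<in>A. of_bool (bad a t))"
      using assms(1) by (simp add: Int_def sum_of_bool_eq)
    also have "\<dots> = (\<Sum>a\<in>A. \<Sum>t::nat<2 ^ m. of_bool (bad a t))" by (rule sum.swap)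
    also have "\<dots> = (\<Sum>a\<in>A. real (card {t. t < 2 ^ m \<and> bad a t}))"
      by (simp add: Int_def)
    also have "\<dots> \<le> (\<Sum>a\<in>A. 2 ^ m * ?C)" by (intro sum_mono one)
    finally show False by (simp add: mult_ac)
  qed
  then show ?thesis using that by (auto simp: bad_def sep_def)
qed

text \<open>For \<open>\<kappa> \<ge> 0\<close> this is the number of vectors of \<open>d\<close>
  integers of absolute value at most \<open>\<lceil>\<kappa> * d\<rceil> + 1\<close>. It will bound
  the number of points at mutual distance at least \<open>\<rho>\<close> in a box of side
  \<open>\<kappa> * \<rho>\<close>, independently of \<open>\<rho>\<close>.\<close>

definition packing_number :: "nat \<Rightarrow> real \<Rightarrow> nat" where
  "packing_number d \<kappa> = (2 * nat \<lceil>\<kappa> * real d\<rceil> + 3) ^ d"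

text \<open>
  In a grid of mesh \<open>\<rho> / d\<close> each cube contains at most one of the points, because the
  Euclidean norm is at most the sum of the absolute values of the coordinates.
\<close>

lemma card_separated_le:
  fixes c :: "'a \<Rightarrow> real ^ 'd::finite"
  assumes "finite S" "0 < \<rho>"
    and sep: "\<And>u v. u \<in> S \<Longrightarrow> v \<in> S \<Longrightarrow> u \<noteq> v \<Longrightarrow> \<rho> \<le> dist (c u) (c v)"
    and box: "\<And>u v i. u \<in> S \<Longrightarrow> v \<in> S \<Longrightarrow> \<bar>c u $ i - c v $ i\<bar> \<le> \<kappa> * \<rho>"
  shows "card S \<le> packing_number (CARD('d)) \<kappa>"
proof (cases "S = {}")
  case False
  then obtain u0 where u0: "u0 \<in> S" by auto
  let ?d = "real CARD('d)"
  define a where "a = int (nat \<lceil>\<kappa> * ?d\<rceil>) + 1"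
  define g where "g u = (\<lambda>i. \<lfloor>(c u $ i - c u0 $ i) * ?d / \<rho>\<rfloor>)" for u
  have dpos: "0 < ?d" by simp
  have "inj_on g S"
  proof (rule inj_onI, rule ccontr)
    fix u v assume uv: "u \<in> S" "v \<in> S" "g u = g v" "u \<noteq> v"
    have "\<bar>(c u - c v) $ i\<bar> < \<rho> / ?d" for i
    proof -
      have "\<lfloor>(c u $ i - c u0 $ i) * ?d / \<rho>\<rfloor> = \<lfloor>(c v $ i - c u0 $ i) * ?d / \<rho>\<rfloor>"
        using fun_cong[OF uv(3), of i] by (simp add: g_def)
      then have "\<bar>(c u $ i - c u0 $ i) * ?d / \<rho> - (c v $ i - c u0 $ i) * ?d / \<rho>\<bar> < 1" by linarith
      also have "(c u $ i - c u0 $ i) * ?d / \<rho> - (c v $ i - c u0 $ i) * ?d / \<rho> = (c u - c v) $ i * (?d / \<rho>)"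
        by (simp add: algebra_simps flip: diff_divide_distrib)
      finally have "\<bar>(c u - c v) $ i\<bar> * \<bar>?d / \<rho>\<bar> < 1" by (simp only: abs_mult)
      then have "\<bar>(c u - c v) $ i\<bar> * (?d / \<rho>) < 1" using dpos assms(2) by simp
      then have "\<bar>(c u - c v) $ i\<bar> < 1 / (?d / \<rho>)"
        using dpos assms(2) by (subst pos_less_divide_eq) auto
      then show ?thesis by simp
    qed
    then have "(\<Sum>i\<in>UNIV. \<bar>(c u - c v) $ i\<bar>) < (\<Sum>i\<in>(UNIV::'d set). \<rho> / ?d)"
      by (intro sum_strict_mono) auto
    then have "norm (c u - c v) < \<rho>"
      using norm_le_l1_cart[of "c u - c v"] by simp
    with sep[OF uv(1,2,4)] show False by (simp add: dist_norm)
  qed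
  moreover have "g ` S \<subseteq> UNIV \<rightarrow>\<^sub>E {-a..a}"
  proof -
    have "g u i \<in> {-a..a}" if "u \<in> S" for u i
    proof -
      have "\<bar>(c u $ i - c u0 $ i) * ?d / \<rho>\<bar> = \<bar>c u $ i - c u0 $ i\<bar> * (?d / \<rho>)"
        using assms(2) by (simp add: abs_mult)
      also have "\<dots> \<le> \<kappa> * \<rho> * (?d / \<rho>)"
        using box[OF that u0, of i] assms(2) by (intro mult_right_mono) auto
      also have "\<dots> = \<kappa> * ?d" using assms(2) by simp
      finally have "\<bar>(c u $ i - c u0 $ i) * ?d / \<rho>\<bar> \<le> \<kappa> * ?d" .
      then show ?thesis unfolding g_def a_def atLeastAtMost_iff by linarith
    qed
    then show ?thesis by auto
  qed
  ultimately have "card S \<le> card ((UNIV :: 'd set) \<rightarrow>\<^sub>E {-a..a})"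
    by (intro card_inj_on_le) (auto intro: finite_PiE)
  also have "\<dots> = nat (2 * a + 1) ^ CARD('d)" by (simp add: card_funcsetE)
  also have "nat (2 * (int n + 1) + 1) = 2 * n + 3" for n by simp
  then have "nat (2 * a + 1) = 2 * nat \<lceil>\<kappa> * ?d\<rceil> + 3" unfolding a_def .
  finally show ?thesis by (simp add: packing_number_def)
qed simp

section \<open>Hyperfiniteness of contact graphs\<close>

text \<open>
  The arcs may form any symmetric subset of the tangencies; all that is used of a tangency is that
  the balls are not apart and that their radii are comparable.
\<close>

locale contact_graph =
  fixes V :: "'a set" and E :: "'a rel" and c :: "'a \<Rightarrow> real ^ 'd::finite" and r :: "'a \<Rightarrow> real"
    and M :: real
  assumes finite_V: "finite V" and E_subset: "E \<subseteq> V \<times> V" and sym_E: "sym E" and M_ge_1: "1 \<le> M"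
    and radius_pos: "v \<in> V \<Longrightarrow> 0 < r v"
    and separated: "u \<in> V \<Longrightarrow> v \<in> V \<Longrightarrow> u \<noteq> v \<Longrightarrow> r u + r v \<le> dist (c u) (c v)"
    and touching: "(u, v) \<in> E \<Longrightarrow> dist (c u) (c v) \<le> r u + r v"
    and ratio: "(u, v) \<in> E \<Longrightarrow> r u \<le> M * r v"
begin

section \<open>Bounded degree of contact graphs\<close>

lemma finite_E: "finite E"
  using finite_V E_subset finite_subset by blast

lemma coordinates_near:
  assumes "(u, v) \<in> E"
  shows "\<bar>c u $ i - c v $ i\<bar> \<le> (M + 1) * r u"
proof -
  \<comment> \<open>Symmetry supplies the radius bound in the other direction,
    \<open>r v \<le> M * r u\<close>.\<close>
  have "(v, u) \<in> E" using assms sym_E by (simp add: sym_def)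
  have "\<bar>c u $ i - c v $ i\<bar> \<le> dist (c u) (c v)"
    using component_le_norm_cart[of "c u - c v" i] by (simp add: dist_norm)
  also have "\<dots> \<le> r u + r v" using touching assms .
  also have "\<dots> \<le> (M + 1) * r u" using ratio[OF \<open>(v, u) \<in> E\<close>] by (simp add: algebra_simps)
  finally show ?thesis .
qed

text \<open>Neighbours of \<open>v\<close> have radius at least \<open>r v / M\<close>, so their
  centres are that far apart, while each coordinate of a centre is within
  \<open>(M + 1) * r v\<close> of that of \<open>v\<close>. In units of \<open>r v / M\<close> the
  box has side \<open>2 * M * (M + 1)\<close>.\<close>

lemma degree_le:
  assumes "v \<in> V"
  shows "card (E `` {v}) \<le> packing_number CARD('d) (2 * M * (M + 1))"
proof (rule card_separated_le[where \<rho> = "r v / M" and c = c])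
  have nbr: "w \<in> V" "r v / M \<le> r w" if "w \<in> E `` {v}" for w
    using that E_subset ratio[of v w] M_ge_1 by (auto simp: field_simps)
  show "finite (E `` {v})" using finite_E by auto
  show "0 < r v / M" using radius_pos[OF assms] M_ge_1 by auto
  show "r v / M \<le> dist (c u) (c w)" if "u \<in> E `` {v}" "w \<in> E `` {v}" "u \<noteq> w" for u w
    using nbr[OF that(1)] nbr[OF that(2)] separated[of u w] that(3) radius_pos[of u] by linarith
  show "\<bar>c u $ i - c w $ i\<bar> \<le> 2 * M * (M + 1) * (r v / M)"
    if "u \<in> E `` {v}" "w \<in> E `` {v}" for u w i
  proof -
    have "\<bar>c u $ i - c w $ i\<bar> \<le> \<bar>c v $ i - c u $ i\<bar> + \<bar>c v $ i - c w $ i\<bar>" by linarith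
    also have "\<dots> \<le> 2 * ((M + 1) * r v)"
      using coordinates_near[of v u i] coordinates_near[of v w i] that by auto
    also have "\<dots> = 2 * M * (M + 1) * (r v / M)" using M_ge_1 by (simp add: field_simps)
    finally show ?thesis .
  qed
qed

section \<open>Bounded clusters from shifted dyadic cubes\<close>

lemma card_E_le:
  assumes "\<And>v. v \<in> V \<Longrightarrow> card (E `` {v}) \<le> \<Delta>"
  shows "card E \<le> \<Delta> * card V"
proof -
  have "E = (SIGMA v:V. E `` {v})" using E_subset by auto
  then have "card E = (\<Sum>v\<in>V. card (E `` {v}))"
    using finite_V finite_E by (metis card_SigmaI finite_Image)
  also have "\<dots> \<le> \<Delta> * card V"
    using sum_bounded_above[of V "\<lambda>v. card (E `` {v})" \<Delta>] assms by (simp add: mult.commute)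
  finally show ?thesis .
qed

text \<open>The class of a vertex is the set of removed cubes containing it. In the bound, the first
  summand counts \<open>far\<close> arcs, one coordinate at a time, and the second counts
  \<open>near\<close> arcs: at most \<open>card V / K\<close> cubes, each with few large balls of
  degree at most \<open>\<Delta>\<close>. The outer factor 2 covers arcs that enter a removed
  cube.\<close>

lemma normalized_clusters:
  fixes T :: real and K :: nat
  assumes r_ge_1: "\<And>v. v \<in> V \<Longrightarrow> 1 \<le> r v" and c_nonneg: "\<And>v i. v \<in> V \<Longrightarrow> 0 \<le> c v $ i"
    and degree: "\<And>v. v \<in> V \<Longrightarrow> card (E `` {v}) \<le> \<Delta>"
    and "1 \<le> T" and K: "packing_number CARD('d) T < K"
  shows "\<exists>cls :: 'a \<Rightarrow> (nat \<times> ('d \<Rightarrow> int)) set.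
    real (card {(u, v) \<in> E. cls u \<noteq> cls v}) \<le>
      2 * (CARD('d) * (2 * (M + 2) / T) * \<Delta> + packing_number CARD('d) T * \<Delta> / K) * card V \<and>
    (\<forall>v\<in>V. card {w \<in> V. cls w = cls v} \<le> 2 ^ CARD('d) * K)"
proof -
  let ?N = "packing_number CARD('d) T"
  \<comment> \<open>With all coordinates in \<open>[0, 2 ^ m)\<close> and shifts below
    \<open>2 ^ m\<close>, one cube of side \<open>2 ^ (m + 1)\<close> holds every centre; it is the
    top cell.\<close>
  obtain m where m: "\<And>v i. v \<in> V \<Longrightarrow> c v $ i < 2 ^ m"
  proof -
    obtain B where B: "\<And>v. v \<in> V \<Longrightarrow> norm (c v) \<le> B"
      using finite_V finite_imp_bounded[of "c ` V"] by (auto simp: bounded_iff)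
    obtain m where "B < 2 ^ m" using real_arch_pow[of 2 B] by auto
    moreover have "c v $ i \<le> B" if "v \<in> V" for v i
      using component_le_norm_cart[of "c v" i] B[OF that] by linarith
    ultimately show ?thesis using that by (meson le_less_trans)
  qed
  \<comment> \<open>A cut arc starting at \<open>u\<close> is in \<open>far\<close> if the cube is large compared to the ball of \<open>u\<close>, and in
    \<open>near\<close> (defined below) otherwise; a cube meets few balls of at least its own scale.\<close>
  define far where "far i t = {a \<in> E. \<exists>j\<le>m. T * r (fst a) < 2 ^ j \<and>
      \<lfloor>(c (fst a) $ i + real t) / 2 ^ j\<rfloor> \<noteq> \<lfloor>(c (snd a) $ i + real t) / 2 ^ j\<rfloor>}" for i t
  have "\<exists>t<2 ^ m. real (card (far i t)) \<le> 2 * (M + 2) / T * real (card E)" for i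
  proof -
    obtain t :: nat where "t < 2 ^ m" "real (card (far i t)) \<le> 2 * (M + 1 + 1) / T * real (card E)"
      unfolding far_def
    proof (rule exists_good_shift)
      show "1 \<le> r (fst a)" if "a \<in> E" for a using r_ge_1 E_subset that by auto
      show "\<bar>c (fst a) $ i - c (snd a) $ i\<bar> \<le> (M + 1) * r (fst a)" if "a \<in> E" for a
        using coordinates_near[of "fst a" "snd a"] that by simp
    qed (use finite_E M_ge_1 \<open>1 \<le> T\<close> in auto)
    moreover have "M + 1 + 1 = M + 2" by simp
    ultimately show ?thesis by metis
  qed
  then have "\<forall>i. \<exists>t. t < 2 ^ m \<and> real (card (far i t)) \<le> 2 * (M + 2) / T * real (card E)" by blast
  then obtain t where "\<forall>i. t i < 2 ^ m \<and> real (card (far i (t i))) \<le> 2 * (M + 2) / T * real (card E)"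
    by (rule choice[THEN exE])
  then have t: "t i < 2 ^ m" and crossing: "real (card (far i (t i))) \<le> 2 * (M + 2) / T * real (card E)" for i
    by blast+
  define cell where "cell j v = (\<lambda>i. \<lfloor>(c v $ i + real (t i)) / 2 ^ j\<rfloor>)" for j v
  have top: "cell (Suc m) v = (\<lambda>_. 0)" if "v \<in> V" for v
  proof
    fix i
    have "real (t i) < 2 ^ m" using t[of i] by (metis of_nat_less_iff of_nat_numeral of_nat_power)
    then have "c v $ i + real (t i) < 2 * 2 ^ m" using m[OF that, of i] by linarith
    then show "cell (Suc m) v i = 0"
      using c_nonneg[OF that, of i] by (simp add: cell_def floor_eq_iff)
  qed
  have children: "card (cell j ` {v \<in> V. cell (Suc j) v = z}) \<le> 2 ^ CARD('d)" for j z
  proof -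
    have "cell j v i \<in> {2 * z i, 2 * z i + 1}" if "cell (Suc j) v = z" for v i
    proof -
      have "\<lfloor>((c v $ i + real (t i)) / 2 ^ j) / 2\<rfloor> = z i"
        using fun_cong[OF that, of i] by (simp add: cell_def mult.commute)
      moreover have "\<lfloor>y / 2\<rfloor> = z \<Longrightarrow> 2 * z \<le> \<lfloor>y\<rfloor> \<and> \<lfloor>y\<rfloor> \<le> 2 * z + 1" for y :: real and z
        by linarith
      ultimately have "2 * z i \<le> cell j v i \<and> cell j v i \<le> 2 * z i + 1"
        unfolding cell_def by blast
      then show ?thesis by auto
    qed
    then have "cell j ` {v \<in> V. cell (Suc j) v = z} \<subseteq> (\<Pi>\<^sub>E i\<in>UNIV. {2 * z i, 2 * z i + 1})"
      by auto
    then have "card (cell j ` {v \<in> V. cell (Suc j) v = z}) \<le> card (\<Pi>\<^sub>E i\<in>(UNIV::'d set). {2 * z i, 2 * z i + 1})"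
      by (intro card_mono finite_PiE) auto
    also have "\<dots> = 2 ^ CARD('d)" by (simp add: card_PiE numeral_2_eq_2)
    finally show ?thesis .
  qed
  \<comment> \<open>A ball counted here has radius at least \<open>2 ^ j / T\<close>, so the centres
    are separated by that distance inside a cube of \<open>T\<close> times that side.\<close>
  have big: "card {v \<in> V. cell j v = z \<and> 2 ^ j \<le> T * r v} \<le> ?N" for j z
  proof (rule card_separated_le[where \<rho> = "2 ^ j / T" and c = c])
    show "2 ^ j / T \<le> dist (c u) (c v)"
      if "u \<in> {v \<in> V. cell j v = z \<and> 2 ^ j \<le> T * r v}" "v \<in> {v \<in> V. cell j v = z \<and> 2 ^ j \<le> T * r v}" "u \<noteq> v" for u v
    proof -
      have "2 ^ j / T \<le> r u" using that \<open>1 \<le> T\<close> by (simp add: field_simps)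
      with that separated[of u v] radius_pos[of v] show ?thesis by auto
    qed
    show "\<bar>c u $ i - c v $ i\<bar> \<le> T * (2 ^ j / T)"
      if "u \<in> {v \<in> V. cell j v = z \<and> 2 ^ j \<le> T * r v}" "v \<in> {v \<in> V. cell j v = z \<and> 2 ^ j \<le> T * r v}" for u v i
    proof -
      have "cell j u i = cell j v i" using that by simp
      then have "\<bar>(c u $ i + real (t i)) / 2 ^ j - (c v $ i + real (t i)) / 2 ^ j\<bar> < 1"
        unfolding cell_def by linarith
      then have "\<bar>(c u $ i - c v $ i) / 2 ^ j\<bar> < 1" by (simp flip: diff_divide_distrib)
      then show ?thesis using \<open>1 \<le> T\<close> by (simp add: abs_divide)
    qed
  qed (use finite_V \<open>1 \<le> T\<close> in auto)
  \<comment> \<open>Since \<open>T\<close> and all radii are at least 1, every ball counts as large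
    at level 0, and \<open>?N < K\<close> makes the bottom cells small.\<close>
  have bottom: "card {v \<in> V. cell 0 v = z} < K" for z
  proof -
    have "1 \<le> T * r v" if "v \<in> V" for v
      using mult_mono[of 1 T 1 "r v"] \<open>1 \<le> T\<close> r_ge_1[OF that] by simp
    then have "{v \<in> V. cell 0 v = z} = {v \<in> V. cell 0 v = z \<and> 2 ^ 0 \<le> T * r v}" by auto
    with big[of 0 z] K show ?thesis by simp
  qed
  obtain Q where Q: "finite Q" "fst ` Q \<subseteq> {..m}" "K * card Q \<le> card V"
    and classes: "\<And>v. v \<in> V \<Longrightarrow> card {w \<in> V. \<forall>(j, z)\<in>Q. cell j w = z \<longleftrightarrow> cell j v = z} \<le> 2 ^ CARD('d) * K"
    using cut_cells[of V K cell m "\<lambda>_. 0" "2 ^ CARD('d)" V] finite_V K top children bottom by auto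
  define cls where "cls v = {(j, z) \<in> Q. cell j v = z}" for v
  \<comment> \<open>\<open>out\<close> holds the arcs leaving a removed cube, and
    \<open>near q\<close> the arcs that start in \<open>q\<close> at a ball that is large for
    it.\<close>
  define out where "out = {(u, v) \<in> E. \<exists>(j, z)\<in>Q. cell j u = z \<and> cell j v \<noteq> z}"
  define near where "near = (\<lambda>(j, z). SIGMA u:{u \<in> V. cell j u = z \<and> 2 ^ j \<le> T * r u}. E `` {u})"
  have "card {w \<in> V. cls w = cls v} \<le> 2 ^ CARD('d) * K" if "v \<in> V" for v
  proof -
    have "cls w = cls v \<longleftrightarrow> (\<forall>(j, z)\<in>Q. cell j w = z \<longleftrightarrow> cell j v = z)" for w
      by (auto simp: cls_def)
    with classes[OF that] show ?thesis by simp
  qed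
  moreover have "real (card {(u, v) \<in> E. cls u \<noteq> cls v}) \<le>
      2 * (CARD('d) * (2 * (M + 2) / T) * \<Delta> + ?N * \<Delta> / K) * card V"
  proof -
    have "out \<subseteq> (\<Union>i\<in>UNIV. far i (t i)) \<union> (\<Union>q\<in>Q. near q)"
    proof
      fix a assume "a \<in> out"
      then obtain u v j z where a: "a = (u, v)" "(u, v) \<in> E" "(j, z) \<in> Q" "cell j u = z" "cell j v \<noteq> z"
        by (auto simp: out_def)
      show "a \<in> (\<Union>i\<in>UNIV. far i (t i)) \<union> (\<Union>q\<in>Q. near q)"
      proof (cases "2 ^ j \<le> T * r u")
        case True
        then have "a \<in> near (j, z)" using a E_subset by (auto simp: near_def)
        with a(3) show ?thesis by blast
      next
        case False
        \<comment> \<open>A cube is left in some coordinate, so each coordinate could be shifted separately.\<close>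
        from a(4,5) obtain i where "cell j u i \<noteq> cell j v i" by fastforce
        with False a Q(2) have "a \<in> far i (t i)"
          by (auto simp: far_def cell_def not_le image_subset_iff intro!: exI[of _ j])
        then show ?thesis by blast
      qed
    qed
    moreover have fin: "finite (far i (t i))" "finite (near q)" for i q
      using finite_E finite_V by (auto simp: far_def near_def split: prod.splits)
    ultimately have "card out \<le> card ((\<Union>i\<in>UNIV. far i (t i)) \<union> (\<Union>q\<in>Q. near q))"
      using Q(1) by (intro card_mono) auto
    also have "\<dots> \<le> card (\<Union>i\<in>UNIV. far i (t i)) + card (\<Union>q\<in>Q. near q)" by (rule card_Un_le)
    also have "\<dots> \<le> (\<Sum>i\<in>UNIV. card (far i (t i))) + (\<Sum>q\<in>Q. card (near q))"
      using Q(1) by (intro add_mono card_UN_le) auto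
    finally have "real (card out) \<le> real ((\<Sum>i\<in>UNIV. card (far i (t i))) + (\<Sum>q\<in>Q. card (near q)))"
      by (simp only: of_nat_le_iff)
    also have "\<dots> = (\<Sum>i\<in>UNIV. real (card (far i (t i)))) + (\<Sum>q\<in>Q. real (card (near q)))" by simp
    also have "\<dots> \<le> (\<Sum>i\<in>(UNIV::'d set). 2 * (M + 2) / T * (real \<Delta> * real (card V))) + (\<Sum>q\<in>Q. real (?N * \<Delta>))"
    proof (intro add_mono sum_mono)
      fix i
      have "real (card E) \<le> real (\<Delta> * card V)" using card_E_le[OF degree] by (simp only: of_nat_le_iff)
      then have "2 * (M + 2) / T * real (card E) \<le> 2 * (M + 2) / T * (real \<Delta> * real (card V))"
        using M_ge_1 \<open>1 \<le> T\<close> by (intro mult_left_mono) auto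
      with crossing[of i] show "real (card (far i (t i))) \<le> 2 * (M + 2) / T * (real \<Delta> * real (card V))"
        by simp
    next
      fix q :: "nat \<times> ('d \<Rightarrow> int)"
      obtain j z where q: "q = (j, z)" by force
      let ?S = "{u \<in> V. cell j u = z \<and> 2 ^ j \<le> T * r u}"
      have "card (near q) = (\<Sum>u\<in>?S. card (E `` {u}))"
        unfolding q near_def using finite_V finite_E by simp
      also have "\<dots> \<le> card ?S * \<Delta>"
        using sum_bounded_above[of ?S "\<lambda>u. card (E `` {u})" \<Delta>] degree by simp
      also have "\<dots> \<le> ?N * \<Delta>" using big by (intro mult_right_mono) auto
      finally show "real (card (near q)) \<le> real (?N * \<Delta>)" by (simp only: of_nat_le_iff)
    qed
    also have "\<dots> = CARD('d) * (2 * (M + 2) / T) * \<Delta> * card V + real (card Q) * (?N * \<Delta>)" by simp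
    also have "real (card Q) \<le> card V / K"
    proof -
      have "real (K * card Q) \<le> real (card V)" using Q(3) by (simp only: of_nat_le_iff)
      then show ?thesis using K by (simp add: field_simps)
    qed
    then have "real (card Q) * (?N * \<Delta>) \<le> card V / K * (?N * \<Delta>)" by (intro mult_right_mono) auto
    finally have out: "real (card out) \<le> CARD('d) * (2 * (M + 2) / T) * \<Delta> * card V + card V / K * (?N * \<Delta>)" by simp
    have "finite out" using finite_E by (auto simp: out_def intro: finite_subset[of _ E])
    \<comment> \<open>Two different classes are told apart by a removed cube containing exactly one
      endpoint, so the arc or its reverse leaves that cube.\<close>
    have "{(u, v) \<in> E. cls u \<noteq> cls v} \<subseteq> out \<union> out\<inverse>"
      using sym_E by (fastforce simp: out_def cls_def sym_def)
    then have "card {(u, v) \<in> E. cls u \<noteq> cls v} \<le> card (out \<union> out\<inverse>)"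
      using \<open>finite out\<close> by (intro card_mono) auto
    also have "\<dots> \<le> card out + card (out\<inverse>)" by (rule card_Un_le)
    also have "\<dots> = 2 * card out" by simp
    finally have "real (card {(u, v) \<in> E. cls u \<noteq> cls v}) \<le> 2 * real (card out)" by linarith
    also have "\<dots> \<le> 2 * (CARD('d) * (2 * (M + 2) / T) * \<Delta> * card V + card V / K * (?N * \<Delta>))"
      using out by simp
    also have "\<dots> = 2 * (CARD('d) * (2 * (M + 2) / T) * \<Delta> + ?N * \<Delta> / K) * card V"
      by (simp add: algebra_simps)
    finally show ?thesis .
  qed
  ultimately show ?thesis by blast
qed

text \<open>The claim mentions only \<open>V\<close> and \<open>E\<close>, so the packing may be
  rescaled by its smallest radius and translated until all coordinates are nonnegative.\<close>

lemma clusters: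
  fixes T :: real and K :: nat
  assumes degree: "\<And>v. v \<in> V \<Longrightarrow> card (E `` {v}) \<le> \<Delta>"
    and T: "1 \<le> T" and K: "packing_number CARD('d) T < K"
  shows "\<exists>cls :: 'a \<Rightarrow> (nat \<times> ('d \<Rightarrow> int)) set.
    real (card {(u, v) \<in> E. cls u \<noteq> cls v}) \<le>
      2 * (CARD('d) * (2 * (M + 2) / T) * \<Delta> + packing_number CARD('d) T * \<Delta> / K) * card V \<and>
    (\<forall>v\<in>V. card {w \<in> V. cls w = cls v} \<le> 2 ^ CARD('d) * K)"
proof (cases "V = {}")
  case True
  then have "E = {}" using E_subset by auto
  with True show ?thesis by auto
next
  case False
  define \<rho> where "\<rho> = Min (r ` V)"
  have \<rho>: "0 < \<rho>" "\<And>v. v \<in> V \<Longrightarrow> \<rho> \<le> r v"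
    using finite_V False radius_pos by (auto simp: \<rho>_def)
  obtain B where B: "\<And>v. v \<in> V \<Longrightarrow> norm (c v) \<le> B"
    using finite_V finite_imp_bounded[of "c ` V"] by (auto simp: bounded_iff)
  define c' where "c' v = (1 / \<rho>) *\<^sub>R (c v + (\<chi> i. B))" for v
  define r' where "r' v = r v / \<rho>" for v
  have dist': "dist (c' u) (c' v) = dist (c u) (c v) / \<rho>" for u v
    using \<rho>(1) by (simp add: c'_def dist_norm flip: scaleR_diff_right)
  interpret scaled: contact_graph V E c' r' M
  proof
    show "r' u + r' v \<le> dist (c' u) (c' v)" if "u \<in> V" "v \<in> V" "u \<noteq> v" for u v
      using divide_right_mono[OF separated[OF that], of \<rho>] \<rho>(1) by (simp add: dist' r'_def add_divide_distrib)
    show "dist (c' u) (c' v) \<le> r' u + r' v" if "(u, v) \<in> E" for u v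
      using divide_right_mono[OF touching[OF that], of \<rho>] \<rho>(1) by (simp add: dist' r'_def add_divide_distrib)
    show "r' u \<le> M * r' v" if "(u, v) \<in> E" for u v
      using divide_right_mono[OF ratio[OF that], of \<rho>] \<rho>(1) by (simp add: r'_def)
  qed (use finite_V E_subset sym_E M_ge_1 radius_pos \<rho>(1) in \<open>auto simp: r'_def\<close>)
  show ?thesis
  proof (rule scaled.normalized_clusters[OF _ _ degree T K])
    show "1 \<le> r' v" if "v \<in> V" for v using \<rho>(1) \<rho>(2)[OF that] by (simp add: r'_def)
    show "0 \<le> c' v $ i" if "v \<in> V" for v i
      using component_le_norm_cart[of "c v" i] B[OF that] \<rho>(1) by (simp add: c'_def)
  qed
qed

end

text \<open>The order of choices matters: \<open>T\<close> makes the \<open>far\<close> term at most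
  \<open>\<epsilon> / 4\<close>, and then \<open>K\<close>, which depends on \<open>T\<close>
  through the packing number, does the same for the \<open>near\<close> term. The degree bound
  \<open>\<Delta>\<close> depends on \<open>M\<close> and the dimension alone, so
  \<open>2 ^ CARD('d) * K\<close> serves all packings at once.\<close>

lemma contact_graphs_hyperfinite:
  fixes M \<epsilon> :: real
  assumes "1 \<le> M" "0 < \<epsilon>"
  obtains B :: nat where
    "\<And>(V :: 'a set) E (c :: 'a \<Rightarrow> real ^ 'd::finite) r. contact_graph V E c r M \<Longrightarrow>
      \<exists>cls :: 'a \<Rightarrow> (nat \<times> ('d \<Rightarrow> int)) set.
        real (card {(u, v) \<in> E. cls u \<noteq> cls v}) \<le> \<epsilon> * card V \<and>
        (\<forall>v\<in>V. card {w \<in> V. cls w = cls v} \<le> B)"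
proof -
  define \<Delta> where "\<Delta> = packing_number CARD('d) (2 * M * (M + 1))"
  define a where "a = real CARD('d) * (2 * (M + 2)) * \<Delta>"
  define T where "T = max 1 (4 * a / \<epsilon>)"
  let ?N = "packing_number CARD('d) T"
  obtain K :: nat where K: "real ?N + 4 * (?N * \<Delta>) / \<epsilon> < K" using reals_Archimedean2 by blast
  have T: "1 \<le> T" by (simp add: T_def)
  have "0 \<le> 4 * real (?N * \<Delta>) / \<epsilon>" using assms by simp
  then have NK: "?N < K" "4 * (?N * \<Delta>) / \<epsilon> < K" using K by linarith+
  have "4 * a / \<epsilon> \<le> T" by (simp add: T_def)
  then have 1: "a / T \<le> \<epsilon> / 4" using assms T by (simp add: field_simps)
  have 2: "?N * \<Delta> / K \<le> \<epsilon> / 4" using NK(2) \<open>?N < K\<close> assms by (simp add: field_simps)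
  have "\<exists>cls :: 'a \<Rightarrow> (nat \<times> ('d \<Rightarrow> int)) set.
        real (card {(u, v) \<in> E. cls u \<noteq> cls v}) \<le> \<epsilon> * card V \<and>
        (\<forall>v\<in>V. card {w \<in> V. cls w = cls v} \<le> 2 ^ CARD('d) * K)"
    if "contact_graph V E c r M" for V :: "'a set" and E and c :: "'a \<Rightarrow> real ^ 'd" and r
  proof -
    interpret contact_graph V E c r M by fact
    have eq: "CARD('d) * (2 * (M + 2) / T) * \<Delta> = a / T" by (simp add: a_def)
    have "2 * (x + y) \<le> \<epsilon>" if "x \<le> \<epsilon> / 4" "y \<le> \<epsilon> / 4" for x y
      using that assms(2) by simp
    from this[OF 1 2] have "2 * (a / T + ?N * \<Delta> / K) * card V \<le> \<epsilon> * card V"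
      by (intro mult_right_mono) auto
    with clusters[OF degree_le[folded \<Delta>_def] T NK(1)] show ?thesis
      unfolding eq by (meson order_trans)
  qed
  then show ?thesis using that by blast
qed

section \<open>Balls that are regular trees\<close>

lemma graph_dist_le_relpow:
  assumes "pair_wf_digraph G" "u \<in> pverts G" "(u, v) \<in> parcs G ^^ n"
  shows "graph_dist G u v \<le> ereal (real n)"
proof -
  interpret pair_wf_digraph G by fact
  have "\<exists>p. awalk u p v \<and> length p = n"
    using assms(2,3)
  proof (induction n arbitrary: u)
    case 0
    then show ?case by (auto simp: awalk_Nil_iff)
  next
    case (Suc n)
    then obtain w where w: "(u, w) \<in> parcs G" "(w, v) \<in> parcs G ^^ n"
      by (meson relpow_Suc_D2)
    with Suc.IH[of w] obtain p where "awalk w p v" "length p = n"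
      using in_arcsD2 by blast
    with w(1) show ?case by (intro exI[of _ "(u, w) # p"]) (auto simp: awalk_Cons_iff)
  qed
  then obtain p where "awalk u p v" "length p = n" by blast
  with min_cost_le_walk_cost[of u p v "\<lambda>_. 1"] show ?thesis
    by (simp add: graph_dist_def awalk_cost_def sum_list_triv)
qed

lemma relpow_if_successively:
  assumes "successively (\<lambda>u v. (u, v) \<in> E) p" "i < length p"
  shows "(hd p, p ! i) \<in> E ^^ i"
  using assms(2)
proof (induction i)
  case 0
  then show ?case by (simp add: hd_conv_nth)
next
  case (Suc i)
  then have "(p ! i, p ! Suc i) \<in> E"
    using assms(1) by (simp add: successively_conv_nth)
  with Suc show ?case by auto
qed

section \<open>Transfer of degrees and cycles along rooted isomorphisms of balls\<close>

abbreviation ball_verts :: "'a pair_pre_digraph \<Rightarrow> 'a \<Rightarrow> nat \<Rightarrow> 'a set" where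
  "ball_verts G v R \<equiv> {u \<in> pverts G. graph_dist G v u \<le> ereal (real R)}"

text \<open>The library isomorphism carries a separate map on arcs. Where arcs are pairs of their
  endpoints, it has to agree with the vertex map, and injectivity on vertices lets arcs be pulled
  back.\<close>

lemma arcs_iff_if_app_iso:
  assumes "pre_digraph.digraph_isomorphism A h" "B = app_iso h A"
    and "tail A = fst" "head A = snd" "tail B = fst" "head B = snd"
    and "u \<in> verts A" "v \<in> verts A"
  shows "(iso_verts h u, iso_verts h v) \<in> arcs B \<longleftrightarrow> (u, v) \<in> arcs A"
proof -
  have inj: "inj_on (iso_verts h) (verts A)" and wf: "wf_digraph A"
    and ends: "iso_verts h (fst a) = fst (iso_arcs h a)" "iso_verts h (snd a) = snd (iso_arcs h a)"
    if "a \<in> arcs A" for a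
    using assms(1-6) that by (auto simp: pre_digraph.digraph_isomorphism_def)
  have "iso_arcs h (u, v) = (iso_verts h u, iso_verts h v)" if "(u, v) \<in> arcs A"
    using ends[OF that] by (simp add: prod_eq_iff)
  moreover have "a = (u, v)" if "a \<in> arcs A" "iso_arcs h a = (iso_verts h u, iso_verts h v)" for a
  proof -
    have "fst a \<in> verts A" "snd a \<in> verts A"
      using wf_digraph.tail_in_verts[OF wf[OF that(1)] that(1)] wf_digraph.head_in_verts[OF wf[OF that(1)] that(1)]
        assms(3,4) by auto
    moreover have "iso_verts h (fst a) = iso_verts h u" "iso_verts h (snd a) = iso_verts h v"
      using ends[OF that(1)] that(2) by auto
    ultimately show ?thesis
      using inj[OF that(1)] assms(7,8) by (auto simp: prod_eq_iff dest: inj_onD)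
  qed
  ultimately show ?thesis unfolding assms(2) arcs_app_iso
    by (metis (no_types, lifting) imageE imageI)
qed

lemma rooted_iso_graph_ballE:
  assumes "rooted_iso (graph_ball G v R) v (graph_ball T x R) x"
  obtains h where "h v = x" "bij_betw h (ball_verts G v R) (ball_verts T x R)"
    "\<And>u w. u \<in> ball_verts G v R \<Longrightarrow> w \<in> ball_verts G v R \<Longrightarrow>
      (h u, h w) \<in> parcs T \<longleftrightarrow> (u, w) \<in> parcs G"
proof -
  obtain h where h: "pre_digraph.digraph_isomorphism (graph_ball G v R) h"
    "graph_ball T x R = app_iso h (graph_ball G v R)" "iso_verts h v = x"
    using assms by (auto simp: rooted_iso_def)
  have inj: "inj_on (iso_verts h) (ball_verts G v R)"
    using h(1) by (simp add: pre_digraph.digraph_isomorphism_def graph_ball_def)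
  have "verts (graph_ball T x R) = iso_verts h ` verts (graph_ball G v R)" by (simp add: h(2))
  then have image: "ball_verts T x R = iso_verts h ` ball_verts G v R" by (simp add: graph_ball_def)
  have "(iso_verts h u, iso_verts h w) \<in> parcs T \<longleftrightarrow> (u, w) \<in> parcs G"
    if "u \<in> ball_verts G v R" "w \<in> ball_verts G v R" for u w
  proof -
    have "iso_verts h u \<in> ball_verts T x R" "iso_verts h w \<in> ball_verts T x R"
      unfolding image using that by blast+
    moreover have "(iso_verts h u, iso_verts h w) \<in> arcs (graph_ball T x R) \<longleftrightarrow> (u, w) \<in> arcs (graph_ball G v R)"
      by (rule arcs_iff_if_app_iso[OF h(1,2)]) (use that in \<open>auto simp: graph_ball_def\<close>)
    ultimately show ?thesis using that by (simp add: graph_ball_def)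
  qed
  then show ?thesis using that[of "iso_verts h"] h(3) inj image by (simp add: bij_betw_def)
qed

text \<open>Since \<open>R\<close> is at least 1, the ball contains all neighbours of its root, so
  the isomorphism matches them with the neighbours of the root of the tree.\<close>

lemma card_neighbours_if_regular_tree_up_to:
  assumes G: "pair_wf_digraph G" and "v \<in> pverts G" "regular_tree_up_to k G v R" "1 \<le> R"
  shows "card (parcs G `` {v}) = k"
proof -
  obtain T :: "nat pair_pre_digraph" and x where T: "regular_tree k T" "x \<in> pverts T"
    and iso: "rooted_iso (graph_ball G v R) v (graph_ball T x R) x"
    using assms(3) by (auto simp: regular_tree_up_to_def)
  have wfT: "pair_wf_digraph T"
    using T(1) by (auto simp: regular_tree_def undirected_tree_def pair_bidirected_digraph_def
        pair_sym_digraph_def)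
  obtain h where h: "h v = x" "bij_betw h (ball_verts G v R) (ball_verts T x R)"
    "\<And>u w. u \<in> ball_verts G v R \<Longrightarrow> w \<in> ball_verts G v R \<Longrightarrow>
      (h u, h w) \<in> parcs T \<longleftrightarrow> (u, w) \<in> parcs G"
    by (rule rooted_iso_graph_ballE[OF iso]) blast
  have ball: "u \<in> ball_verts H w R"
    if "pair_wf_digraph H" "w \<in> pverts H" "(w, u) \<in> parcs H \<or> u = w" for H :: "'b pair_pre_digraph" and u w
  proof -
    have "(w, u) \<in> parcs H ^^ 1 \<or> (w, u) \<in> parcs H ^^ 0" using that(3) by auto
    then have "graph_dist H w u \<le> ereal (real 1) \<or> graph_dist H w u \<le> ereal (real 0)"
      using graph_dist_le_relpow[OF that(1,2)] by blast
    then have "graph_dist H w u \<le> ereal (real R)"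
      using \<open>1 \<le> R\<close> by (auto intro: order_trans)
    moreover have "u \<in> pverts H" using that pair_wf_digraph.in_arcsD2 by metis
    ultimately show ?thesis by simp
  qed
  have "h ` (parcs G `` {v}) = parcs T `` {x}"
  proof (intro equalityI subsetI)
    fix y assume "y \<in> h ` (parcs G `` {v})"
    then obtain u where "y = h u" "(v, u) \<in> parcs G" by auto
    then show "y \<in> parcs T `` {x}"
      using h(3)[of v u] ball[OF G assms(2)] h(1) by auto
  next
    fix y assume "y \<in> parcs T `` {x}"
    then have y: "(x, y) \<in> parcs T" by simp
    then have "y \<in> ball_verts T x R" using ball[OF wfT T(2)] by blast
    then obtain u where u: "u \<in> ball_verts G v R" "y = h u"
      using h(2) by (auto simp: bij_betw_def)
    with y h(1) h(3)[of v u] ball[OF G assms(2), of v] show "y \<in> h ` (parcs G `` {v})" by auto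
  qed
  moreover have "inj_on h (parcs G `` {v})"
    using ball[OF G assms(2)] h(2) by (auto simp: bij_betw_def intro: inj_on_subset)
  ultimately have "card (parcs G `` {v}) = card (parcs T `` {x})"
    by (metis card_image)
  also have "\<dots> = card (out_arcs (with_proj T) x)"
  proof -
    have "out_arcs (with_proj T) x = Pair x ` (parcs T `` {x})" by (auto simp: out_arcs_def)
    then show ?thesis by (simp add: card_image inj_on_def)
  qed
  also have "\<dots> = k" using T by (simp add: regular_tree_def out_degree_def)
  finally show ?thesis .
qed

text \<open>Passes from lists of vertices to the library's lists of arcs by pairing each vertex with
  its cyclic successor. The length is recorded because \<open>undirected_tree\<close> excludes
  cycles with at least three arcs.\<close>

lemma cycle_if_undirected_cycle:
  assumes "pair_wf_digraph T" "undirected_cycle (parcs T) p"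
  obtains q where "pre_digraph.cycle (with_proj T) q" "length q = length p"
proof -
  interpret pair_wf_digraph T by fact
  obtain u xs where p: "p = u # xs" using assms(2) by (cases p) (auto simp: undirected_cycle_def)
  let ?q = "zip (u # xs) (xs @ [u])"
  have cas: "pcas a (zip (a # ys) (ys @ [b])) b" for a b :: 'a and ys
    by (induction ys arbitrary: a) auto
  have verts: "pawalk_verts a (zip (a # ys) (ys @ [b])) = a # ys @ [b]" for a b :: 'a and ys
    by (induction ys arbitrary: a) auto
  have arcs: "set (zip (a # ys) (ys @ [b])) \<subseteq> parcs T"
    if "successively (\<lambda>u v. (u, v) \<in> parcs T) (a # ys)" "(last (a # ys), b) \<in> parcs T" for a b ys
    using that by (induction ys arbitrary: a) auto
  have "set ?q \<subseteq> parcs T" using assms(2) by (intro arcs) (auto simp: undirected_cycle_def p)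
  moreover have "u \<in> pverts T"
    using assms(2) in_arcsD2 by (auto simp: undirected_cycle_def p split: if_splits)
  ultimately have "awalk u ?q u" using cas by (simp add: awalk_def)
  moreover have "distinct (tl (pawalk_verts u ?q))"
    using assms(2) unfolding verts by (auto simp: undirected_cycle_def p)
  moreover have "length ?q = length p" by (simp add: p)
  moreover have "?q \<noteq> []" by (cases xs) auto
  ultimately show ?thesis using that[of ?q] unfolding cycle_def by blast
qed

lemma no_undirected_cycle_if_regular_tree_up_to:
  assumes "regular_tree_up_to k G v R" "set p \<subseteq> ball_verts G v R"
  shows "\<not> undirected_cycle (parcs G) p"
proof
  assume p: "undirected_cycle (parcs G) p"
  obtain T :: "nat pair_pre_digraph" and x where T: "regular_tree k T" "x \<in> pverts T"
    and iso: "rooted_iso (graph_ball G v R) v (graph_ball T x R) x"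
    using assms(1) by (auto simp: regular_tree_up_to_def)
  have wfT: "pair_wf_digraph T"
    using T(1) by (auto simp: regular_tree_def undirected_tree_def pair_bidirected_digraph_def
        pair_sym_digraph_def)
  obtain h where h: "bij_betw h (ball_verts G v R) (ball_verts T x R)"
    "\<And>u w. u \<in> ball_verts G v R \<Longrightarrow> w \<in> ball_verts G v R \<Longrightarrow>
      (h u, h w) \<in> parcs T \<longleftrightarrow> (u, w) \<in> parcs G"
    by (rule rooted_iso_graph_ballE[OF iso]) blast
  have "p \<noteq> []" using p by (auto simp: undirected_cycle_def)
  have "inj_on h (set p)" using h(1) assms(2) by (auto simp: bij_betw_def intro: inj_on_subset)
  moreover have "successively (\<lambda>u v. (h u, h v) \<in> parcs T) p"
    unfolding successively_conv_nth
  proof (intro allI impI)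
    fix i assume i: "Suc i < length p"
    then have "p ! i \<in> ball_verts G v R" "p ! Suc i \<in> ball_verts G v R"
      using assms(2) by (meson Suc_lessD nth_mem subsetD)+
    moreover have "(p ! i, p ! Suc i) \<in> parcs G"
      using p i by (simp add: undirected_cycle_def successively_conv_nth)
    ultimately show "(h (p ! i), h (p ! Suc i)) \<in> parcs T" using h(2) by blast
  qed
  moreover have "(h (last p), h (hd p)) \<in> parcs T"
    using p assms(2) h(2)[of "last p" "hd p"] last_in_set[OF \<open>p \<noteq> []\<close>] hd_in_set[OF \<open>p \<noteq> []\<close>]
    by (auto simp: undirected_cycle_def)
  ultimately have "undirected_cycle (parcs T) (map h p)"
    using p \<open>p \<noteq> []\<close>
    by (auto simp: undirected_cycle_def distinct_map successively_map last_map hd_map)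
  then obtain q where "pre_digraph.cycle (with_proj T) q" "length q = length (map h p)"
    using cycle_if_undirected_cycle[OF wfT] by metis
  moreover have "3 \<le> length p" using p by (simp add: undirected_cycle_def)
  ultimately show False using T(1) by (auto simp: regular_tree_def undirected_tree_def)
qed

section \<open>Uniform packings of locally tree-like graphs\<close>

text \<open>If the centres were closer, the point \<open>x\<close> dividing the segment from
  \<open>a\<close> to \<open>b\<close> in the ratio \<open>r : s\<close> would lie in both open
  balls.\<close>

lemma radius_add_le_dist_if_disjoint_balls:
  fixes a b :: "'a :: real_normed_vector"
  assumes "0 < r" "0 < s" "ball a r \<inter> ball b s = {}"
  shows "r + s \<le> dist a b"
proof (rule ccontr)
  assume "\<not> ?thesis"
  then have d: "dist a b < r + s" by simp
  define x where "x = a + (r / (r + s)) *\<^sub>R (b - a)"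
  have "b - x = (s / (r + s)) *\<^sub>R (b - a)"
  proof -
    have "b - x = (1 - r / (r + s)) *\<^sub>R (b - a)" by (simp add: x_def algebra_simps)
    also have "1 - r / (r + s) = s / (r + s)" using assms by (simp add: field_simps)
    finally show ?thesis .
  qed
  then have "dist b x = s / (r + s) * dist a b" "dist a x = r / (r + s) * dist a b"
    using assms by (simp_all add: dist_norm norm_minus_commute x_def)
  moreover have "t / (r + s) * dist a b < t" if "0 < t" for t
    using mult_strict_left_mono[OF d that] assms(1,2) by (simp add: pos_divide_less_eq)
  ultimately have "x \<in> ball a r \<inter> ball b s" using assms(1,2) by simp
  with assms(3) show False by simp
qed

text \<open>Centres and radii are pulled back along the isomorphism. Passing to
  \<open>max 1 M\<close> only weakens the ratio bound and meets the assumption \<open>M_ge_1\<close>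
  of the locale.\<close>

lemma contact_graph_if_uniform_in_dim:
  assumes G: "pair_graph G" and "uniform_in_dim TYPE('d::finite) M G"
  obtains c :: "'a \<Rightarrow> real ^ 'd" and r where
    "contact_graph (pverts G) (parcs G) c r (max 1 M)"
proof -
  interpret pair_graph G by fact
  obtain V :: "'a set" and c :: "'a \<Rightarrow> real ^ 'd" and r h where packing: "uniform_packing M V c r"
    and h: "pre_digraph.digraph_isomorphism (with_proj G) h"
      "with_proj (tangency_graph V c r) = app_iso h (with_proj G)"
    using assms(2) by (auto simp: uniform_in_dim_def digraph_iso_def)
  define \<phi> where "\<phi> = iso_verts h"
  have "inj_on \<phi> (pverts G)"
    using h(1) by (simp add: pre_digraph.digraph_isomorphism_def \<phi>_def)
  have "verts (with_proj (tangency_graph V c r)) = \<phi> ` pverts G" by (simp add: h(2) \<phi>_def)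
  then have V: "V = \<phi> ` pverts G" by (simp add: tangency_graph_def)
  have arc: "tangent c r (\<phi> u) (\<phi> v)" if "(u, v) \<in> parcs G" for u v
    using arcs_iff_if_app_iso[OF h, of u v] that wellformed'[OF that] by (simp add: \<phi>_def tangency_graph_def)
  have pos: "\<And>v. v \<in> pverts G \<Longrightarrow> 0 < r (\<phi> v)"
    using packing by (auto simp: V uniform_packing_def sphere_packing_def)
  have "contact_graph (pverts G) (parcs G) (\<lambda>v. c (\<phi> v)) (\<lambda>v. r (\<phi> v)) (max 1 M)"
  proof
    show "r (\<phi> u) + r (\<phi> v) \<le> dist (c (\<phi> u)) (c (\<phi> v))"
      if "u \<in> pverts G" "v \<in> pverts G" "u \<noteq> v" for u v
    proof (rule radius_add_le_dist_if_disjoint_balls)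
      have "\<phi> u \<noteq> \<phi> v" using \<open>inj_on \<phi> (pverts G)\<close> that by (auto dest: inj_onD)
      with packing that show "ball (c (\<phi> u)) (r (\<phi> u)) \<inter> ball (c (\<phi> v)) (r (\<phi> v)) = {}"
        by (auto simp: V uniform_packing_def sphere_packing_def disjoint_family_on_def interior_cball
            simp del: mem_ball)
    qed (use pos that in auto)
    show "dist (c (\<phi> u)) (c (\<phi> v)) \<le> r (\<phi> u) + r (\<phi> v)" if "(u, v) \<in> parcs G" for u v
      using arc[OF that] by (simp add: tangent_def)
    show "r (\<phi> u) \<le> max 1 M * r (\<phi> v)" if "(u, v) \<in> parcs G" for u v
    proof -
      have "r (\<phi> u) / r (\<phi> v) \<le> M"
        using packing arc[OF that] wellformed'[OF that] by (auto simp: V uniform_packing_def)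
      then have "r (\<phi> u) / r (\<phi> v) \<le> max 1 M" by simp
      then show ?thesis using pos wellformed'[OF that] by (simp add: pos_divide_le_eq)
    qed
    show "sym (parcs G)" using pair_sym_arcs by (simp add: symmetric_def)
  qed (use pos pair_finite_verts wellformed' in auto)
  then show ?thesis using that by blast
qed

text \<open>A cycle of these arcs stays in one class, so it has at most \<open>R\<close> vertices
  and lies in the ball of radius \<open>R\<close> around its first vertex. That ball is a tree, so
  there is no such cycle and the arcs form a forest.\<close>

lemma tree_clusters_arcs_le:
  assumes G: "pair_graph G"
    and classes: "\<And>v. v \<in> pverts G \<Longrightarrow> card {w \<in> pverts G. cls w = cls v} \<le> R"
  shows "card {(u, v) \<in> parcs G. cls u = cls v \<and> regular_tree_up_to k G u R \<and> regular_tree_up_to k G v R}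
    \<le> 2 * card (pverts G)" (is "card ?F \<le> _")
proof (rule card_acyclic_le)
  interpret pair_graph G by fact
  show "finite (pverts G)" by (rule pair_finite_verts)
  show "?F \<subseteq> pverts G \<times> pverts G" using wellformed' by auto
  show "sym ?F" using pair_sym_arcs by (auto simp: symmetric_def sym_def)
  show "irrefl ?F" using pair_no_loops by (fastforce simp: irrefl_def)
  show "\<not> undirected_cycle ?F p" for p
  proof
    assume p: "undirected_cycle ?F p"
    then have "p \<noteq> []" and walk: "successively (\<lambda>u v. (u, v) \<in> ?F) p" and "distinct p"
      by (auto simp: undirected_cycle_def)
    \<comment> \<open>The closing arc from \<open>last p\<close> to \<open>hd p\<close> belongs to
      \<open>?F\<close>, which makes the first vertex tree-like.\<close>
    have hd: "hd p \<in> pverts G" "regular_tree_up_to k G (hd p) R"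
      using p wellformed'(2)[of "last p" "hd p"] by (auto simp: undirected_cycle_def)
    have walk_G: "successively (\<lambda>u v. (u, v) \<in> parcs G) p"
      using walk by (rule successively_subrel) auto
    have in_class: "p ! i \<in> {w \<in> pverts G. cls w = cls (hd p)}" if "i < length p" for i
      using that
    proof (induction i)
      case 0
      then show ?case using hd \<open>p \<noteq> []\<close> by (simp add: hd_conv_nth)
    next
      case (Suc i)
      then have "(p ! i, p ! Suc i) \<in> ?F" using walk by (simp add: successively_conv_nth)
      with Suc show ?case using wellformed' by auto
    qed
    then have "set p \<subseteq> {w \<in> pverts G. cls w = cls (hd p)}" by (auto simp: in_set_conv_nth)
    then have "card (set p) \<le> card {w \<in> pverts G. cls w = cls (hd p)}"
      using pair_finite_verts by (intro card_mono) auto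
    then have "length p \<le> R" using classes[OF hd(1)] \<open>distinct p\<close> by (simp add: distinct_card)
    have "p ! i \<in> ball_verts G (hd p) R" if "i < length p" for i
    proof -
      have "graph_dist G (hd p) (p ! i) \<le> ereal (real i)"
        using relpow_if_successively[OF walk_G that] hd(1)
        by (intro graph_dist_le_relpow) unfold_locales
      also have "\<dots> \<le> ereal (real R)" using that \<open>length p \<le> R\<close> by simp
      finally show ?thesis using in_class[OF that] by simp
    qed
    then have "set p \<subseteq> ball_verts G (hd p) R" by (auto simp: in_set_conv_nth)
    moreover have "undirected_cycle (parcs G) p"
      using p walk_G by (auto simp: undirected_cycle_def)
    ultimately show False using no_undirected_cycle_if_regular_tree_up_to[OF hd(2)] by blast
  qed
qed

text \<open>Arcs are counted by their tails, \<open>k\<close> for each good vertex. Such an arc is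
  in the forest, or cut, or ends at a bad vertex; in the last case its reverse is one of at most
  \<open>\<Delta>\<close> arcs starting there.\<close>

lemma tree_degree_sum_le:
  fixes \<epsilon> :: real and k :: nat
  assumes G: "pair_graph G" and "1 \<le> R"
    and classes: "\<And>v. v \<in> pverts G \<Longrightarrow> card {w \<in> pverts G. cls w = cls v} \<le> R"
    and cut: "real (card {(u, v) \<in> parcs G. cls u \<noteq> cls v}) \<le> \<epsilon> * card (pverts G)"
    and degree: "\<And>v. v \<in> pverts G \<Longrightarrow> card (parcs G `` {v}) \<le> \<Delta>"
  defines "good \<equiv> {v \<in> pverts G. regular_tree_up_to k G v R}"
  shows "real k * card good \<le>
    (2 + \<epsilon>) * card (pverts G) + real \<Delta> * (real (card (pverts G)) - card good)"
proof -
  interpret pair_graph G by fact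
  let ?V = "pverts G" and ?E = "parcs G"
  let ?F = "{(u, v) \<in> ?E. cls u = cls v \<and> regular_tree_up_to k G u R \<and> regular_tree_up_to k G v R}"
  let ?C = "{(u, v) \<in> ?E. cls u \<noteq> cls v}"
  let ?D = "SIGMA v:?V - good. ?E `` {v}"
  have fin: "finite good" "finite ?V" "finite ?E"
    using pair_finite_verts pair_finite_arcs by (auto simp: good_def)
  have finF: "finite ?F" "finite ?C" using fin(3) by (auto intro: finite_subset[of _ ?E])
  have wf: "pair_wf_digraph G" by unfold_locales
  have "card (?E `` {v}) = k" if "v \<in> good" for v
    using card_neighbours_if_regular_tree_up_to[OF wf _ _ \<open>1 \<le> R\<close>] that by (simp add: good_def)
  then have "k * card good = (\<Sum>v\<in>good. card (?E `` {v}))" by (simp add: mult.commute)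
  also have "\<dots> = card (SIGMA v:good. ?E `` {v})" using fin by (intro card_SigmaI[symmetric]) auto
  also have "(SIGMA v:good. ?E `` {v}) \<subseteq> ?F \<union> (?C \<union> ?D\<inverse>)"
    using wellformed' pair_sym_arcs by (auto simp: good_def symmetric_def sym_def)
  then have "card (SIGMA v:good. ?E `` {v}) \<le> card (?F \<union> (?C \<union> ?D\<inverse>))"
    using fin finF by (intro card_mono) auto
  also have "\<dots> \<le> card ?F + (card ?C + card (?D\<inverse>))"
    by (meson add_left_mono card_Un_le order_trans)
  also have "card (?D\<inverse>) = (\<Sum>v\<in>?V - good. card (?E `` {v}))" using fin by simp
  also have "\<dots> \<le> \<Delta> * card (?V - good)"
    using sum_bounded_above[of "?V - good" "\<lambda>v. card (?E `` {v})" \<Delta>] degree by (simp add: mult.commute)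
  also have "card ?F \<le> 2 * card ?V" by (rule tree_clusters_arcs_le[OF G classes])
  finally have "k * card good \<le> 2 * card ?V + (card ?C + \<Delta> * card (?V - good))" by simp
  then have "real (k * card good) \<le> real (2 * card ?V + (card ?C + \<Delta> * card (?V - good)))"
    by (simp only: of_nat_le_iff)
  moreover have "real (card (?V - good)) = real (card ?V) - card good"
    using fin by (subst card_Diff_subset) (auto simp: good_def of_nat_diff card_mono)
  ultimately show ?thesis using cut by (simp add: algebra_simps)
qed

theorem corollary4p3:
  fixes G :: "nat \<Rightarrow> 'a pair_pre_digraph"
    and f :: "nat \<Rightarrow> nat"
    and k :: nat
  assumes "CARD('d::finite) \<ge> 2"
    and "\<And>n. pair_graph (G n)"
    and "\<And>n. Digraph_Component.connected (with_proj (G n))"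
    and "filterlim f at_top at_top"
    and "k \<ge> 3"
    and "(\<lambda>n. real (card {v \<in> pverts (G n). regular_tree_up_to k (G n) v (f n)})
                / real (card (pverts (G n)))) \<longlonglongrightarrow> 1"
  shows "\<forall>M::real. M \<ge> 0 \<longrightarrow> (\<exists>n0. \<forall>n\<ge>n0. \<not> uniform_in_dim TYPE('d) M (G n))"
proof (intro allI impI)
  fix M :: real
  define M' where "M' = max 1 M"
  have "1 \<le> M'" by (simp add: M'_def)
  define \<Delta> where "\<Delta> = packing_number CARD('d) (2 * M' * (M' + 1))"
  \<comment> \<open>Chosen so that \<open>(real \<Delta> + 3) * (1 - \<delta>)\<close> equals
    \<open>real \<Delta> + 11 / 4\<close>, which exceeds the \<open>real \<Delta> + 5 / 2\<close> of
    the final inequality.\<close>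
  define \<delta> :: real where "\<delta> = 1 / (4 * (real \<Delta> + 3))"
  have \<delta>: "0 < \<delta>" "\<delta> < 1" "(real \<Delta> + 3) * \<delta> = 1 / 4" by (simp_all add: \<delta>_def field_simps)
  \<comment> \<open>With half an arc per vertex cut, forest and cut arcs together number at most
    \<open>5 / 2\<close> per vertex, below the 3 or more arcs at each good vertex.\<close>
  have "(0::real) < 1 / 2" by simp
  obtain B where B: "\<And>(V :: 'a set) E (c :: 'a \<Rightarrow> real ^ 'd) r. contact_graph V E c r M' \<Longrightarrow>
      \<exists>cls :: 'a \<Rightarrow> (nat \<times> ('d \<Rightarrow> int)) set.
        real (card {(u, v) \<in> E. cls u \<noteq> cls v}) \<le> 1 / 2 * card V \<and>
        (\<forall>v\<in>V. card {w \<in> V. cls w = cls v} \<le> B)"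
    by (rule contact_graphs_hyperfinite[OF \<open>1 \<le> M'\<close> \<open>0 < 1 / 2\<close>]) blast
  let ?good = "\<lambda>n. {v \<in> pverts (G n). regular_tree_up_to k (G n) v (f n)}"
  \<comment> \<open>The radius has to reach \<open>B\<close>, the bound on class sizes, and to be at
    least 1 so that the ball shows the degree of its root.\<close>
  have "eventually (\<lambda>n. max 1 B \<le> f n) at_top"
    using assms(4) unfolding filterlim_at_top by blast
  moreover have "eventually (\<lambda>n. 1 - \<delta> < real (card (?good n)) / real (card (pverts (G n)))) at_top"
    using order_tendstoD(1)[OF assms(6)] \<delta>(1) by simp
  ultimately have "eventually (\<lambda>n. \<not> uniform_in_dim TYPE('d) M (G n)) at_top"
  proof eventually_elim
    case (elim n)
    let ?N = "real (card (pverts (G n)))"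
    show ?case
    proof
      assume "uniform_in_dim TYPE('d) M (G n)"
      then obtain c :: "'a \<Rightarrow> real ^ 'd" and r where
        contact: "contact_graph (pverts (G n)) (parcs (G n)) c r M'"
        using contact_graph_if_uniform_in_dim[OF assms(2)] unfolding M'_def by blast
      obtain cls :: "'a \<Rightarrow> (nat \<times> ('d \<Rightarrow> int)) set" where
        cls: "real (card {(u, v) \<in> parcs (G n). cls u \<noteq> cls v}) \<le> 1 / 2 * ?N"
          "\<And>v. v \<in> pverts (G n) \<Longrightarrow> card {w \<in> pverts (G n). cls w = cls v} \<le> f n"
        using B[OF contact] elim(1) by (meson le_trans max.boundedE)
      have "0 < real (card (?good n)) / ?N" using elim(2) \<delta>(2) by linarith
      \<comment> \<open>Division by zero yields 0, so a positive ratio also rules out an empty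
        graph.\<close>
      then have "?N \<noteq> 0" by (metis div_by_0 less_irrefl)
      then have "0 < ?N" by (metis of_nat_0_le_iff order_le_less)
      then have good: "(1 - \<delta>) * ?N < real (card (?good n))" using elim(2) by (simp add: field_simps)
      have "real k * card (?good n) \<le> (2 + 1 / 2) * ?N + real \<Delta> * (?N - card (?good n))"
        using elim(1) by (intro tree_degree_sum_le[OF assms(2) _ cls(2,1)])
          (auto simp: \<Delta>_def intro: contact_graph.degree_le[OF contact])
      moreover have "3 * real (card (?good n)) \<le> real k * card (?good n)"
        using assms(5) by (intro mult_right_mono) auto
      ultimately have "(real \<Delta> + 3) * card (?good n) \<le> (real \<Delta> + 5 / 2) * ?N"
        by (simp add: algebra_simps)
      moreover have "(real \<Delta> + 3) * ((1 - \<delta>) * ?N) < (real \<Delta> + 3) * card (?good n)"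
        using good by (intro mult_strict_left_mono) auto
      moreover have "(real \<Delta> + 3) * ((1 - \<delta>) * ?N) = (real \<Delta> + 3 - (real \<Delta> + 3) * \<delta>) * ?N"
        by (simp add: algebra_simps)
      ultimately have "(real \<Delta> + 3 - 1 / 4) * ?N < (real \<Delta> + 5 / 2) * ?N" unfolding \<delta>(3) by linarith
      with \<open>0 < ?N\<close> show False by simp
    qed
  qed
  then show "\<exists>n0. \<forall>n\<ge>n0. \<not> uniform_in_dim TYPE('d) M (G n)" by (simp add: eventually_at_top_linorder)
qed

end
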